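(* (a) Let $n\ge 1$. If $A \subset \mathbb{Z}_{2n+1}$ is a game subset with $\Gamma[A]$ reducible, then $A = m_a(Odd_n)$ for a unique $a \in \mathbb{Z}_{2n+1}^*$. Conversely, for $a \in \mathbb{Z}_{2n+1}^*$, $a$ is the unique element of $\mathbb{Z}_{2n+1}$ such that $\Gamma[m_a(Odd_n)]$ is reducible via $0 \to a$. (b) If a group $G$ of odd order is not cyclic, then for no game subset $A$ of $G$ is $\Gamma[A]$ reducible.
   Context: A tournament on a finite set $I$ is a relation $\Pi\subset I\times I$ without loops such that for distinct $i,j$ exactly one of $(i,j),(j,i)$ is in $\Pi$; write $i\to j$ for $(i,j)\in \Pi$. A game is a tournament on a set of odd size $2n+1$ in which every vertex has exactly $n$ outputs and $n$ inputs (the empty relation on a singleton is the trivial game). A game $\Gamma$ on $I$ is reducible via $\{u,v\}$ (or via $u \to v$, when $u\to v$ in $\Gamma$) when the restriction $\Gamma \cap (J \times J)$ with $J = I \setminus\{u,v\}$ is a game on $J$; $\Gamma$ is reducible if it is reducible via some pair of distinct vertices. For a finite group $G$ of odd order with identity $e$, a game subset is $A \subset G$ such that $G$ is the disjoint union $A \cup A^{-1} \cup \{e\}$; the associated game on $G$ is $\Gamma[A] = \{(i,j) : i^{-1}j\in A\}$. $\mathbb{Z}_{2n+1}$ is the additive group of integers mod $2n+1$, $\mathbb{Z}_{2n+1}^*$ the group of units of the ring, $m_a(i) = ai$, and $Odd_n = \{2k-1 : k = 1,\dots,n\} \subset \mathbb{Z}_{2n+1}$. *)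

theory Defs
  imports "HOL-Algebra.Algebra" "HOL-Number_Theory.Residues"
begin

section \<open>Tournaments and games\<close>

definition tournament :: "'a set \<Rightarrow> 'a rel \<Rightarrow> bool" where
  "tournament I T \<longleftrightarrow>
     finite I \<and> T \<subseteq> I \<times> I \<and>
     (\<forall>i\<in>I. (i, i) \<notin> T) \<and>
     (\<forall>i\<in>I. \<forall>j\<in>I. i \<noteq> j \<longrightarrow> ((i, j) \<in> T) \<noteq> ((j, i) \<in> T))"

text \<open>The case \<open>n = 0\<close> is the trivial game on a singleton.\<close>

definition game :: "'a set \<Rightarrow> 'a rel \<Rightarrow> bool" where
  "game I \<Gamma> \<longleftrightarrow>
     tournament I \<Gamma> \<and>
     (\<exists>n. card I = 2 * n + 1 \<and>
          (\<forall>i\<in>I. card {j. (i, j) \<in> \<Gamma>} = n \<and> card {j. (j, i) \<in> \<Gamma>} = n))"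

text \<open>
  The following three predicates are only meant for relations \<open>\<Gamma>\<close> with \<open>game I \<Gamma>\<close>.
  The first one is symmetric in \<open>u\<close> and \<open>v\<close>, the second one takes the orientation
  of the pair into account.
\<close>

definition reducible_via :: "'a set \<Rightarrow> 'a rel \<Rightarrow> 'a \<Rightarrow> 'a \<Rightarrow> bool" where
  "reducible_via I \<Gamma> u v \<longleftrightarrow>
     u \<in> I \<and> v \<in> I \<and> u \<noteq> v \<and>
     game (I - {u, v}) (\<Gamma> \<inter> ((I - {u, v}) \<times> (I - {u, v})))"

definition reducible_via_arrow :: "'a set \<Rightarrow> 'a rel \<Rightarrow> 'a \<Rightarrow> 'a \<Rightarrow> bool" where
  "reducible_via_arrow I \<Gamma> u v \<longleftrightarrow> (u, v) \<in> \<Gamma> \<and> reducible_via I \<Gamma> u v"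

definition reducible :: "'a set \<Rightarrow> 'a rel \<Rightarrow> bool" where
  "reducible I \<Gamma> \<longleftrightarrow> (\<exists>u v. reducible_via I \<Gamma> u v)"

section \<open>Games on groups\<close>

text \<open>\<open>carrier G\<close> is the disjoint union of \<open>A\<close>, the set of inverses of \<open>A\<close>, and \<open>{\<one>}\<close>.\<close>

definition game_subset :: "('a, 'b) monoid_scheme \<Rightarrow> 'a set \<Rightarrow> bool" where
  "game_subset G A \<longleftrightarrow>
     carrier G = A \<union> set_inv\<^bsub>G\<^esub> A \<union> {\<one>\<^bsub>G\<^esub>} \<and>
     A \<inter> set_inv\<^bsub>G\<^esub> A = {} \<and>
     \<one>\<^bsub>G\<^esub> \<notin> A \<and> \<one>\<^bsub>G\<^esub> \<notin> set_inv\<^bsub>G\<^esub> A"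

definition assoc_game :: "('a, 'b) monoid_scheme \<Rightarrow> 'a set \<Rightarrow> 'a rel" where
  "assoc_game G A =
     {(i, j). i \<in> carrier G \<and> j \<in> carrier G \<and> inv\<^bsub>G\<^esub> i \<otimes>\<^bsub>G\<^esub> j \<in> A}"

lemma (in group) game_assoc_game:
  assumes fin: "finite (carrier G)" and A: "game_subset G A"
  shows "game (carrier G) (assoc_game G A)"
proof -
  have cover: "carrier G = A \<union> set_inv A \<union> {\<one>}" and disj: "A \<inter> set_inv A = {}"
    and one: "\<one> \<notin> A" "\<one> \<notin> set_inv A"
    using A unfolding game_subset_def by blast+
  have sub: "A \<subseteq> carrier G" "set_inv A \<subseteq> carrier G"
    using cover by blast+
  have set_inv_image: "set_inv A = m_inv G ` A"
    unfolding SET_INV_def by blast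
  have inv_iff: "x \<in> set_inv A \<longleftrightarrow> inv x \<in> A" if "x \<in> carrier G" for x
    using that subsetD[OF sub(1)] unfolding set_inv_image
    by (auto intro: image_eqI[of _ _ "inv x"])
  have finA: "finite A" "finite (set_inv A)"
    using sub fin finite_subset by blast+
  have card_inv: "card (set_inv A) = card A"
    unfolding set_inv_image using inv_inj sub(1) by (intro card_image) (rule inj_on_subset)
  have inv_arg: "inv (inv i \<otimes> j) = inv j \<otimes> i"
    if "i \<in> carrier G" "j \<in> carrier G" for i j
    using that by (simp add: inv_mult_group)
  have "card (carrier G) = card (A \<union> set_inv A) + 1"
    unfolding cover using finA one by simp
  then have card_G: "card (carrier G) = 2 * card A + 1"
    using finA disj card_inv by (simp add: card_Un_disjoint)
  have translate: "card ((\<lambda>a. i \<otimes> a) ` B) = card B"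
    if "i \<in> carrier G" "B \<subseteq> carrier G" for i B
    using that by (intro card_image inj_onI) (meson l_cancel subsetD)
  have outs: "{j. (i, j) \<in> assoc_game G A} = (\<lambda>a. i \<otimes> a) ` A" if i: "i \<in> carrier G" for i
  proof safe
    fix j assume j: "(i, j) \<in> assoc_game G A"
    then have "j = i \<otimes> (inv i \<otimes> j)"
      using i by (simp add: assoc_game_def m_assoc[symmetric])
    then show "j \<in> (\<lambda>a. i \<otimes> a) ` A"
      using j by (auto simp: assoc_game_def)
  next
    fix a assume "a \<in> A"
    then show "(i, i \<otimes> a) \<in> assoc_game G A"
      using i sub by (auto simp: assoc_game_def m_assoc[symmetric])
  qed
  have ins: "{j. (j, i) \<in> assoc_game G A} = (\<lambda>a. i \<otimes> a) ` (set_inv A)"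
    if i: "i \<in> carrier G" for i
  proof safe
    fix j assume j: "(j, i) \<in> assoc_game G A"
    then have jG: "j \<in> carrier G" and "inv j \<otimes> i \<in> A"
      by (auto simp: assoc_game_def)
    then have "inv i \<otimes> j \<in> set_inv A"
      using i by (simp add: inv_iff inv_arg)
    moreover have "j = i \<otimes> (inv i \<otimes> j)"
      using i jG by (simp add: m_assoc[symmetric])
    ultimately show "j \<in> (\<lambda>a. i \<otimes> a) ` (set_inv A)"
      by blast
  next
    fix a assume a: "a \<in> set_inv A"
    then have aG: "a \<in> carrier G" and "inv a \<in> A"
      using sub inv_iff by auto
    moreover have "inv (i \<otimes> a) \<otimes> i = inv a"
      using i aG by (simp add: inv_mult_group m_assoc)
    ultimately show "(i \<otimes> a, i) \<in> assoc_game G A"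
      using i by (simp add: assoc_game_def)
  qed
  have irrefl: "(i, i) \<notin> assoc_game G A" if "i \<in> carrier G" for i
    using one(1) that by (simp add: assoc_game_def)
  have total: "((i, j) \<in> assoc_game G A) \<noteq> ((j, i) \<in> assoc_game G A)"
    if i: "i \<in> carrier G" and j: "j \<in> carrier G" and ij: "i \<noteq> j" for i j
  proof -
    have "inv i \<otimes> j \<noteq> \<one>"
      using i j ij inv_equality[of "inv i" j] by auto
    moreover have "inv i \<otimes> j \<in> carrier G"
      using i j by simp
    ultimately have "(inv i \<otimes> j \<in> A) \<noteq> (inv i \<otimes> j \<in> set_inv A)"
      using cover disj by blast
    then show ?thesis
      using i j by (simp add: assoc_game_def inv_iff inv_arg)
  qed
  have "tournament (carrier G) (assoc_game G A)"
    unfolding tournament_def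
  proof (intro conjI ballI impI)
    show "assoc_game G A \<subseteq> carrier G \<times> carrier G"
      unfolding assoc_game_def by blast
  qed (fact fin, erule irrefl, erule (2) total)
  then show ?thesis
    unfolding game_def using card_G
    by (intro conjI exI[of _ "card A"] ballI)
      (simp_all add: outs ins translate[OF _ sub(1)] translate[OF _ sub(2)] card_inv)
qed

section \<open>The cyclic groups of odd order\<close>

abbreviation Zring :: "nat \<Rightarrow> int ring" where
  "Zring n \<equiv> residue_ring (2 * int n + 1)"

abbreviation Zgroup :: "nat \<Rightarrow> int monoid" where
  "Zgroup n \<equiv> add_monoid (Zring n)"

text \<open>
  The numbers \<open>2 * k - 1\<close> for \<open>1 \<le> k \<le> n\<close> lie in \<open>{0..2 * n} = carrier (Zring n)\<close>,
  so no reduction modulo \<open>2 * n + 1\<close> is needed.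
\<close>

definition Odds :: "nat \<Rightarrow> int set" where
  "Odds n = (\<lambda>k. 2 * int k - 1) ` {1..n}"

definition mult_map :: "nat \<Rightarrow> int \<Rightarrow> int \<Rightarrow> int" where
  "mult_map n a i = a \<otimes>\<^bsub>Zring n\<^esub> i"

end

theory Submission
  imports Defs
begin

text \<open>
  Let \<open>u \<rightarrow> v\<close> be a reducing pair and \<open>a = u\<^sup>-\<^sup>1 v\<close>. Every other vertex beats exactly one of
  \<open>u\<close>, \<open>v\<close>, which says that exactly one of \<open>x\<close>, \<open>x a\<close> lies in \<open>A\<close> for
  \<open>x \<noteq> e, a\<^sup>-\<^sup>1\<close>. So membership alternates along each coset of \<open>\<langle>a\<rangle>\<close>, except at the
  two places above in \<open>\<langle>a\<rangle>\<close> itself; as \<open>a\<close> has odd order no other coset can exist, and \<open>A\<close>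
  consists of the odd powers of \<open>a\<close>. If \<open>b = a\<^sup>c\<close> with \<open>c \<ge> 3\<close> odd were another reducing element for
  the same \<open>A\<close>, then \<open>x = a\<^sup>-\<^sup>2\<close> violates the alternation: \<open>x\<close> and \<open>x b = a\<^bsup>c-2\<^esup>\<close> are
  both odd powers.
\<close>

section \<open>Reducing a game\<close>

lemma reducible_via_sym: "reducible_via I \<Gamma> u v \<longleftrightarrow> reducible_via I \<Gamma> v u"
  unfolding reducible_via_def by (auto simp: insert_commute)

text \<open>The two membership tests enter as summands, so later degree comparisons become linear
  arithmetic.\<close>

lemma card_remove2:
  assumes "finite S" "u \<noteq> v"
  shows "card S = card (S - {u, v}) + of_bool (u \<in> S) + of_bool (v \<in> S)"
proof -
  have "card S = card (S - {u, v}) + card (S \<inter> {u, v})"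
    using assms by (metis card_Diff_subset_Int card_mono Int_lower1 finite.emptyI
        finite.insertI finite_Int le_add_diff_inverse2)
  moreover have "card (S \<inter> {u, v}) = of_bool (u \<in> S) + of_bool (v \<in> S)"
    using assms by (cases "u \<in> S"; cases "v \<in> S") auto
  ultimately show ?thesis by simp
qed

lemma tournament_restrict:
  assumes "tournament I \<Gamma>" "J \<subseteq> I"
  shows "tournament J (\<Gamma> \<inter> (J \<times> J))"
  using assms unfolding tournament_def by (blast intro: finite_subset)

text \<open>Deleting two vertices lowers the required degree \<open>n\<close> by one, so each
  remaining vertex must lose exactly one output, hence exactly one arrow to \<open>u\<close> or
  \<open>v\<close>. The inputs then take care of themselves.\<close>

lemma reducible_via_iff:
  assumes g: "game I \<Gamma>" and u: "u \<in> I" and v: "v \<in> I" and uv: "u \<noteq> v"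
  shows "reducible_via I \<Gamma> u v \<longleftrightarrow> (\<forall>i\<in>I - {u, v}. ((i, u) \<in> \<Gamma>) \<noteq> ((i, v) \<in> \<Gamma>))"
proof -
  let ?J = "I - {u, v}"
  let ?\<Delta> = "\<Gamma> \<inter> (?J \<times> ?J)"
  from g obtain n where t: "tournament I \<Gamma>" and cI: "card I = 2 * n + 1"
    and deg: "\<And>i. i \<in> I \<Longrightarrow> card {j. (i, j) \<in> \<Gamma>} = n"
      "\<And>i. i \<in> I \<Longrightarrow> card {j. (j, i) \<in> \<Gamma>} = n"
    unfolding game_def by blast
  have fin: "finite I" and sub: "\<Gamma> \<subseteq> I \<times> I"
    using t by (auto simp: tournament_def)
  have cJ: "card I = card ?J + 2"
    using card_remove2[OF fin uv] u v by simp
  have n: "n \<ge> 1" using cI cJ by simp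
  have flip: "((w, i) \<in> \<Gamma>) = ((i, w) \<notin> \<Gamma>)" if "i \<in> ?J" "w \<in> {u, v}" for i w
    using t that u v unfolding tournament_def by (metis DiffE insert_iff singletonD)
  have outs: "n = card {j. (i, j) \<in> ?\<Delta>} + of_bool ((i, u) \<in> \<Gamma>) + of_bool ((i, v) \<in> \<Gamma>)"
    if i: "i \<in> ?J" for i
  proof -
    have "{j. (i, j) \<in> ?\<Delta>} = {j. (i, j) \<in> \<Gamma>} - {u, v}"
      using sub i by auto
    moreover have "finite {j. (i, j) \<in> \<Gamma>}"
      using sub fin by (auto intro: finite_subset)
    ultimately show ?thesis
      using card_remove2[OF _ uv, of "{j. (i, j) \<in> \<Gamma>}"] deg(1)[of i] i by simp
  qed
  have ins: "n = card {j. (j, i) \<in> ?\<Delta>} + of_bool ((u, i) \<in> \<Gamma>) + of_bool ((v, i) \<in> \<Gamma>)"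
    if i: "i \<in> ?J" for i
  proof -
    have "{j. (j, i) \<in> ?\<Delta>} = {j. (j, i) \<in> \<Gamma>} - {u, v}"
      using sub i by auto
    moreover have "finite {j. (j, i) \<in> \<Gamma>}"
      using sub fin by (auto intro: finite_subset)
    ultimately show ?thesis
      using card_remove2[OF _ uv, of "{j. (j, i) \<in> \<Gamma>}"] deg(2)[of i] i by simp
  qed
  show ?thesis
  proof
    assume "reducible_via I \<Gamma> u v"
    then have "game ?J ?\<Delta>" by (simp add: reducible_via_def)
    then obtain m where "card ?J = 2 * m + 1" and m: "\<forall>i\<in>?J. card {j. (i, j) \<in> ?\<Delta>} = m"
      unfolding game_def by blast
    then have "n = m + 1" using cI cJ by simp
    show "\<forall>i\<in>?J. ((i, u) \<in> \<Gamma>) \<noteq> ((i, v) \<in> \<Gamma>)"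
    proof
      fix i assume i: "i \<in> ?J"
      have "of_bool ((i, u) \<in> \<Gamma>) + of_bool ((i, v) \<in> \<Gamma>) = (1 :: nat)"
        using outs[OF i] bspec[OF m i] \<open>n = m + 1\<close> by linarith
      then show "((i, u) \<in> \<Gamma>) \<noteq> ((i, v) \<in> \<Gamma>)"
        by (cases "(i, u) \<in> \<Gamma>"; cases "(i, v) \<in> \<Gamma>") simp_all
    qed
  next
    assume alt: "\<forall>i\<in>?J. ((i, u) \<in> \<Gamma>) \<noteq> ((i, v) \<in> \<Gamma>)"
    have "card {j. (i, j) \<in> ?\<Delta>} = n - 1 \<and> card {j. (j, i) \<in> ?\<Delta>} = n - 1" if i: "i \<in> ?J" for i
    proof -
      have "of_bool ((i, u) \<in> \<Gamma>) + of_bool ((i, v) \<in> \<Gamma>) = (1 :: nat)"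
        using bspec[OF alt i] by (cases "(i, u) \<in> \<Gamma>"; cases "(i, v) \<in> \<Gamma>") simp_all
      \<comment> \<open>Since \<open>i\<close> beats exactly one of \<open>u\<close>,
        \<open>v\<close>, the other one beats \<open>i\<close>, so one input is lost as
        well.\<close>
      moreover have "of_bool ((u, i) \<in> \<Gamma>) + of_bool ((v, i) \<in> \<Gamma>) = (1 :: nat)"
        using bspec[OF alt i] flip[OF i]
        by (cases "(i, u) \<in> \<Gamma>"; cases "(i, v) \<in> \<Gamma>") simp_all
      ultimately show ?thesis
        using outs[OF i] ins[OF i] by linarith
    qed
    moreover have "card ?J = 2 * (n - 1) + 1" using cI cJ n by simp
    ultimately have "game ?J ?\<Delta>"
      unfolding game_def using tournament_restrict[OF t, of ?J] by blast
    then show "reducible_via I \<Gamma> u v"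
      using u v uv by (simp add: reducible_via_def)
  qed
qed

section \<open>Reducible games on groups\<close>

text \<open>This is the reducibility criterion for \<open>u\<close> and \<open>v\<close> in the
  coordinate x = \<open>inv i \<otimes> u\<close>, with a = \<open>inv u \<otimes> v\<close>. The
  exempt points \<open>\<one>\<close> and \<open>inv a\<close> are the deleted vertices i = u and i
  = v.\<close>

definition (in group) alternating :: "'a set \<Rightarrow> 'a \<Rightarrow> bool" where
  "alternating A a \<longleftrightarrow> a \<in> A \<and> (\<forall>x \<in> carrier G - {\<one>, inv a}. (x \<in> A) \<noteq> (x \<otimes> a \<in> A))"

text \<open>The multiplicative counterpart of the set \<open>m_a(Odd_n)\<close>. Starting at k = 1
  keeps the natural subtraction exact.\<close>

definition (in group) odd_powers :: "nat \<Rightarrow> 'a \<Rightarrow> 'a set" where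
  "odd_powers n a = (\<lambda>k. a [^] (2 * k - 1)) ` {1..n}"

context group
begin

section \<open>Game subsets, and reducing pairs as an alternation condition\<close>

lemma set_inv_iff:
  assumes "A \<subseteq> carrier G" "x \<in> carrier G"
  shows "x \<in> set_inv A \<longleftrightarrow> inv x \<in> A"
  using assms by (force simp: SET_INV_def)

lemma game_subset_iff:
  "game_subset G A \<longleftrightarrow>
     A \<subseteq> carrier G \<and> \<one> \<notin> A \<and> (\<forall>x \<in> carrier G - {\<one>}. (x \<in> A) \<noteq> (inv x \<in> A))"
    (is "?L \<longleftrightarrow> ?R")
proof
  assume L: ?L
  then have sub: "A \<subseteq> carrier G"
    unfolding game_subset_def by blast
  with L show ?R
    using set_inv_iff[OF sub] unfolding game_subset_def by blast
next
  assume R: ?R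
  then have sub: "A \<subseteq> carrier G" by blast
  then have subi: "set_inv A \<subseteq> carrier G"
    by (auto simp: SET_INV_def)
  have mem: "x \<in> set_inv A \<longleftrightarrow> x \<noteq> \<one> \<and> x \<notin> A" if "x \<in> carrier G" for x
    unfolding set_inv_iff[OF sub that] using R that by (metis DiffI inv_one singletonD)
  show ?L
    unfolding game_subset_def
  proof (intro conjI)
    show "carrier G = A \<union> set_inv A \<union> {\<one>}"
      using sub subi mem by blast
    show "A \<inter> set_inv A = {}" "\<one> \<notin> A" "\<one> \<notin> set_inv A"
      using R sub mem by blast+
  qed
qed

text \<open>The game is invariant under left translation, so only \<open>inv u \<otimes> v\<close>
  matters. With x = \<open>inv i \<otimes> u\<close>, the arrows from i to u and v read x \<in> A
  and \<open>x \<otimes> a \<in> A\<close>.\<close>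

lemma reducible_via_arrow_iff_alternating:
  assumes fin: "finite (carrier G)" and A: "game_subset G A"
    and u: "u \<in> carrier G" and v: "v \<in> carrier G"
  shows "reducible_via_arrow (carrier G) (assoc_game G A) u v \<longleftrightarrow> alternating A (inv u \<otimes> v)"
proof (cases "inv u \<otimes> v \<in> A")
  case False
  then show ?thesis
    by (simp add: reducible_via_arrow_def alternating_def assoc_game_def)
next
  case True
  let ?a = "inv u \<otimes> v"
  have "\<one> \<notin> A"
    using A unfolding game_subset_iff by blast
  then have uv: "u \<noteq> v"
    using True u by auto
  have inv_a: "inv ?a = inv v \<otimes> u"
    using u v by (simp add: inv_mult_group)
  have edge_u: "((i, u) \<in> assoc_game G A) = (inv i \<otimes> u \<in> A)"
    and edge_v: "((i, v) \<in> assoc_game G A) = (inv i \<otimes> u \<otimes> ?a \<in> A)" if "i \<in> carrier G" for i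
  proof -
    have "u \<otimes> ?a = v"
      using u v by (simp add: m_assoc[symmetric])
    then show "((i, u) \<in> assoc_game G A) = (inv i \<otimes> u \<in> A)"
      "((i, v) \<in> assoc_game G A) = (inv i \<otimes> u \<otimes> ?a \<in> A)"
      using that u v by (simp_all add: assoc_game_def m_assoc)
  qed
  have vertices: "(\<lambda>i. inv i \<otimes> u) ` (carrier G - {u, v}) = carrier G - {\<one>, inv ?a}" (is "?f ` _ = _")
  proof -
    have "?f ` carrier G = carrier G"
    proof
      show "carrier G \<subseteq> ?f ` carrier G"
      proof
        fix x assume "x \<in> carrier G"
        then show "x \<in> ?f ` carrier G"
          \<comment> \<open>The witness solves \<open>inv i \<otimes> u = x\<close> for i.\<close>
          using u by (intro image_eqI[of _ _ "u \<otimes> inv x"]) (simp_all add: inv_mult_group m_assoc)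
      qed
    qed (use u in auto)
    moreover have "inj_on ?f (carrier G)"
      using u by (intro inj_onI) (metis inv_closed inv_inv right_cancel)
    then have "?f ` (carrier G - {u, v}) = ?f ` carrier G - ?f ` {u, v}"
      using u v by (intro inj_on_image_set_diff) auto
    ultimately show ?thesis
      using u inv_a by simp
  qed
  have "reducible_via_arrow (carrier G) (assoc_game G A) u v \<longleftrightarrow>
      reducible_via (carrier G) (assoc_game G A) u v"
    using True u v by (simp add: reducible_via_arrow_def assoc_game_def)
  also have "\<dots> \<longleftrightarrow> (\<forall>i\<in>carrier G - {u, v}. (?f i \<in> A) \<noteq> (?f i \<otimes> ?a \<in> A))"
    unfolding reducible_via_iff[OF game_assoc_game[OF fin A] u v uv] using edge_u edge_v by blast
  also have "\<dots> \<longleftrightarrow> alternating A ?a"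
    using True unfolding alternating_def vertices[symmetric] by blast
  finally show ?thesis .
qed

text \<open>Reducibility ignores the orientation of the pair, so u and v may be swapped to make it
  an arrow.\<close>

lemma reducible_imp_alternating:
  assumes fin: "finite (carrier G)" and A: "game_subset G A"
    and red: "reducible (carrier G) (assoc_game G A)"
  obtains a where "a \<in> carrier G" "alternating A a"
proof -
  obtain u v where r: "reducible_via (carrier G) (assoc_game G A) u v"
    using red by (auto simp: reducible_def)
  then have uv: "u \<in> carrier G" "v \<in> carrier G" "u \<noteq> v"
    by (auto simp: reducible_via_def)
  have "tournament (carrier G) (assoc_game G A)"
    using game_assoc_game[OF fin A] by (simp add: game_def)
  then have "(u, v) \<in> assoc_game G A \<or> (v, u) \<in> assoc_game G A"
    using uv unfolding tournament_def by blast
  then show thesis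
    using r uv reducible_via_sym that reducible_via_arrow_iff_alternating[OF fin A]
    unfolding reducible_via_arrow_def by (metis inv_closed m_closed)
qed

section \<open>From alternation to the odd powers of a generator\<close>

lemma carrier_eq_powers:
  assumes fin: "finite (carrier G)" and a: "a \<in> carrier G" and ord: "ord a = order G"
  shows "carrier G = (\<lambda>k. a [^] k) ` {..<order G}"
proof -
  have "inj_on (\<lambda>k. a [^] k) {0 .. ord a - 1}"
    by (rule ord_inj[OF a])
  moreover have "{0 .. ord a - 1} = {..<order G}"
    using ord_ge_1[OF fin a] ord by auto
  ultimately have "card ((\<lambda>k. a [^] k) ` {..<order G}) = card (carrier G)"
    by (simp add: card_image order_def)
  then show ?thesis
    using fin a by (intro card_subset_eq[symmetric]) auto
qed

lemma alternating_imp_odd_powers: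
  assumes fin: "finite (carrier G)" and odd: "order G = 2 * n + 1"
    and A: "game_subset G A" and a: "a \<in> carrier G" and alt: "alternating A a"
  shows "ord a = 2 * n + 1" "A = odd_powers n a"
proof -
  have one: "\<one> \<notin> A" and sub: "A \<subseteq> carrier G"
    using A unfolding game_subset_iff by blast+
  have aA: "a \<in> A" and step: "\<And>x. x \<in> carrier G \<Longrightarrow> x \<noteq> \<one> \<Longrightarrow> x \<noteq> inv a \<Longrightarrow> (x \<otimes> a \<in> A) \<noteq> (x \<in> A)"
    using alt unfolding alternating_def by blast+
  have "ord a dvd 2 * n + 1"
    using ord_dvd_group_order[OF a] odd by simp
  then have odd_ord: "odd (ord a)"
    by (metis dvd_trans even_plus_one_iff even_mult_iff even_numeral)
  \<comment> \<open>Starting from a \<in> A, the induction passes from k to k + 1 only while 0 < k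
    and k + 1 < \<open>ord a\<close>, which keeps \<open>a [^] k\<close> away from both exempt
    points.\<close>
  have powers: "a [^] k \<in> A \<longleftrightarrow> odd k" if "0 < k" "k < ord a" for k :: nat
    using that
  proof (induction k)
    case (Suc k)
    show ?case
    proof (cases "k = 0")
      case True
      then show ?thesis using a aA by simp
    next
      case False
      have "a [^] k \<noteq> \<one>"
        using Suc.prems False pow_eq_id[OF a, of k] by (auto dest: dvd_imp_le)
      moreover have "a [^] k \<noteq> inv a"
      proof
        assume "a [^] k = inv a"
        then have "a [^] Suc k = \<one>" using a by simp
        then show False
          using Suc.prems pow_eq_id[OF a, of "Suc k"] by (auto dest: dvd_imp_le)
      qed
      ultimately have "(a [^] Suc k \<in> A) \<noteq> (a [^] k \<in> A)"
        using step[of "a [^] k"] a by simp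
      then show ?thesis using Suc False by simp
    qed
  qed simp
  have all: "y \<in> range (\<lambda>k::nat. a [^] k)" if y: "y \<in> carrier G" for y
  proof (rule ccontr)
    assume no: "y \<notin> range (\<lambda>k::nat. a [^] k)"
    \<comment> \<open>Inverses of powers are rewritten as natural powers, so that a \<open>y\<close>
      outside the range of natural powers is no such inverse either.\<close>
    have gen: "a [^] (k * (ord a - 1)) = inv (a [^] k)" for k :: nat
    proof -
      have "k * (ord a - 1) + k = ord a * k"
        using ord_ge_1[OF fin a] by (simp add: algebra_simps)
      then show ?thesis
        using a by (intro inv_equality[symmetric]) (simp_all add: nat_pow_mult pow_eq_id)
    qed
    \<comment> \<open>The coset of \<open>y\<close> avoids both exempt points, so the alternation
      runs along it without a break.\<close>
    have coset: "y \<otimes> a [^] k \<noteq> \<one>" "y \<otimes> a [^] k \<noteq> inv a" for k :: nat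
    proof -
      show *: "y \<otimes> a [^] k \<noteq> \<one>" for k :: nat
      proof
        assume "y \<otimes> a [^] k = \<one>"
        then have "y = inv (a [^] k)"
          using a y by (metis inv_equality nat_pow_closed)
        then show False using no gen[of k] by (metis rangeI)
      qed
      show "y \<otimes> a [^] k \<noteq> inv a"
      proof
        assume "y \<otimes> a [^] k = inv a"
        then have "y \<otimes> a [^] Suc k = \<one>"
          using a y by (simp add: m_assoc[symmetric])
        then show False using *[of "Suc k"] by simp
      qed
    qed
    have "(y \<otimes> a [^] k \<in> A) = ((y \<in> A) = even k)" for k :: nat
    proof (induction k)
      case (Suc k)
      have "(y \<otimes> a [^] Suc k \<in> A) \<noteq> (y \<otimes> a [^] k \<in> A)"
        using step[OF _ coset] a y by (simp add: m_assoc)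
      then show ?case using Suc by auto
    qed (use y in simp)
    \<comment> \<open>After \<open>ord a\<close> steps the walk is back at \<open>y\<close>, but an
      odd number of flips has reversed its membership in A.\<close>
    from this[of "ord a"] show False
      using a y odd_ord by simp
  qed
  have range: "carrier G = (\<lambda>k. a [^] k) ` {0..ord a - 1}"
  proof -
    have "range (\<lambda>k::nat. a [^] k) = (\<lambda>k. a [^] k) ` {0..ord a - 1}"
      using ord_elems[OF fin a] unfolding setcompr_eq_image Collect_mem_eq .
    moreover have "carrier G = range (\<lambda>k::nat. a [^] k)"
      using all a by blast
    ultimately show ?thesis by simp
  qed
  then have "card (carrier G) = card {0..ord a - 1}"
    using ord_inj[OF a] by (simp add: card_image)
  then show ord: "ord a = 2 * n + 1"
    using odd ord_ge_1[OF fin a] by (simp add: order_def)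
  show "A = odd_powers n a"
  proof
    show "odd_powers n a \<subseteq> A"
      using powers ord by (auto simp: odd_powers_def)
    show "A \<subseteq> odd_powers n a"
    proof
      fix x assume x: "x \<in> A"
      then obtain k where k: "x = a [^] k" "k \<le> 2 * n"
        using sub range ord by auto
      with x one have "k \<noteq> 0" by (metis nat_pow_0)
      then have "odd k" using powers k x ord by auto
      \<comment> \<open>The index set of \<open>odd_powers\<close> starts at 1, so the exponent 2l +
        1 belongs to the index \<open>Suc l\<close>.\<close>
      then obtain l where "k = 2 * l + 1" by (elim oddE)
      then have "a [^] k = a [^] (2 * Suc l - 1)" "Suc l \<in> {1..n}" using k by auto
      then show "x \<in> odd_powers n a"
        unfolding odd_powers_def k(1) by (rule image_eqI)
    qed
  qed
qed

section \<open>The odd powers of a generator, and how they determine it\<close>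

lemma pow_mem_odd_powers_iff:
  assumes a: "a \<in> carrier G" and ord: "ord a = 2 * n + 1" and k: "k \<le> 2 * n"
  shows "a [^] k \<in> odd_powers n a \<longleftrightarrow> odd k"
proof
  assume "a [^] k \<in> odd_powers n a"
  then obtain l where "l \<in> {1..n}" "a [^] k = a [^] (2 * l - 1)"
    by (auto simp: odd_powers_def)
  then have "k = 2 * l - 1"
    using inj_onD[OF ord_inj[OF a], of k "2 * l - 1"] ord k by auto
  then show "odd k" using \<open>l \<in> {1..n}\<close> by simp
next
  assume "odd k"
  then obtain l where "k = 2 * l + 1" by (elim oddE)
  then have "a [^] k = a [^] (2 * Suc l - 1)" "Suc l \<in> {1..n}" using k by auto
  then show "a [^] k \<in> odd_powers n a"
    unfolding odd_powers_def by (rule image_eqI)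
qed

lemma inv_pow_eq:
  assumes a: "a \<in> carrier G" and "k \<le> ord a"
  shows "inv (a [^] k) = a [^] (ord a - k)"
  using assms by (intro inv_equality) (simp_all add: nat_pow_mult)

text \<open>Inversion sends the exponent k to 2n + 1 - k, which has the opposite parity.\<close>

lemma game_subset_odd_powers:
  assumes fin: "finite (carrier G)" and order: "order G = 2 * n + 1"
    and a: "a \<in> carrier G" and ord: "ord a = 2 * n + 1"
  shows "game_subset G (odd_powers n a)"
  unfolding game_subset_iff
proof (intro conjI ballI)
  show "odd_powers n a \<subseteq> carrier G"
    using a by (auto simp: odd_powers_def)
  show "\<one> \<notin> odd_powers n a"
    using pow_mem_odd_powers_iff[OF a ord, of 0] by simp
  fix x assume x: "x \<in> carrier G - {\<one>}"
  then obtain k where k: "x = a [^] k" "k < 2 * n + 1"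
    using carrier_eq_powers[OF fin a] ord order by auto
  with x have "k \<noteq> 0" by (metis DiffE insertI1 nat_pow_0)
  then show "(x \<in> odd_powers n a) \<noteq> (inv x \<in> odd_powers n a)"
    using k ord by (simp add: inv_pow_eq[OF a] pow_mem_odd_powers_iff[OF a ord])
qed

text \<open>Multiplication by \<open>a\<close> raises the exponent by one and so flips its parity,
  unless the exponent wraps around.\<close>

lemma alternating_odd_powers:
  assumes fin: "finite (carrier G)" and order: "order G = 2 * n + 1"
    and a: "a \<in> carrier G" and ord: "ord a = 2 * n + 1" and n: "n \<ge> 1"
  shows "alternating (odd_powers n a) a"
  unfolding alternating_def
proof (intro conjI ballI)
  show "a \<in> odd_powers n a"
    using pow_mem_odd_powers_iff[OF a ord, of 1] n a by simp
  fix x assume x: "x \<in> carrier G - {\<one>, inv a}"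
  then obtain k where k: "x = a [^] k" "k < 2 * n + 1"
    using carrier_eq_powers[OF fin a] ord order by auto
  \<comment> \<open>The only wrap-around would be at \<open>a [^] (2 * n)\<close>, which is the
    exempt point \<open>inv a\<close>.\<close>
  have "k \<noteq> 2 * n"
    using x k inv_pow_eq[OF a, of 1] ord a by auto
  moreover have "x \<otimes> a = a [^] Suc k" using k by simp
  ultimately show "(x \<in> odd_powers n a) \<noteq> (x \<otimes> a \<in> odd_powers n a)"
    using k pow_mem_odd_powers_iff[OF a ord, of k] pow_mem_odd_powers_iff[OF a ord, of "Suc k"]
    by simp
qed

lemma alternating_odd_powers_unique:
  assumes fin: "finite (carrier G)" and order: "order G = 2 * n + 1"
    and a: "a \<in> carrier G" and ord: "ord a = 2 * n + 1"
    and alt: "alternating (odd_powers n a) b"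
  shows "b = a"
proof (rule ccontr)
  assume "b \<noteq> a"
  from alt have b: "b \<in> odd_powers n a" by (simp add: alternating_def)
  then obtain l where l: "1 \<le> l" "l \<le> n" "b = a [^] (2 * l - 1)"
    by (auto simp: odd_powers_def)
  with \<open>b \<noteq> a\<close> a have "l \<noteq> 1" by auto
  with l have l2: "2 \<le> l" by simp
  \<comment> \<open>As \<open>a\<close> has order 2n + 1, this is the inverse square of
    \<open>a\<close>.\<close>
  let ?x = "a [^] (2 * n - 1)"
  have x: "?x \<in> odd_powers n a"
    using l by (simp add: pow_mem_odd_powers_iff[OF a ord])
  have "inv b = a [^] (2 * n + 1 - (2 * l - 1))"
    using inv_pow_eq[OF a, of "2 * l - 1"] l ord by simp
  \<comment> \<open>Both exempt points for \<open>b\<close> are even powers of \<open>a\<close>, so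
    the odd power \<open>?x\<close> is neither and the alternation applies to it.\<close>
  then have "inv b \<notin> odd_powers n a"
    using l pow_mem_odd_powers_iff[OF a ord, of "2 * n + 1 - (2 * l - 1)"] by simp
  moreover have "\<one> \<notin> odd_powers n a"
    using pow_mem_odd_powers_iff[OF a ord, of 0] by simp
  ultimately have "?x \<otimes> b \<notin> odd_powers n a"
    using x a alt unfolding alternating_def by (metis DiffI emptyE insertE nat_pow_closed)
  moreover have "?x \<otimes> b = a [^] (2 * l - 3)"
  proof -
    \<comment> \<open>Subtracting one full period leaves the exponent 2l - 3, still odd and positive
      because l is at least 2.\<close>
    have "(2 * n - 1) + (2 * l - 1) = ord a + (2 * l - 3)"
      using l l2 ord by simp
    then have "?x \<otimes> b = a [^] (ord a + (2 * l - 3))"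
      unfolding l(3) using a by (simp add: nat_pow_mult)
    also have "\<dots> = a [^] (2 * l - 3)"
      using a by (simp flip: nat_pow_mult)
    finally show ?thesis .
  qed
  ultimately show False
    using l l2 pow_mem_odd_powers_iff[OF a ord, of "2 * l - 3"] by simp
qed

lemma reducible_imp_cyclic:
  assumes fin: "finite (carrier G)" and odd: "odd (order G)"
    and A: "game_subset G A" and red: "reducible (carrier G) (assoc_game G A)"
  shows "cyclic_group G"
proof -
  obtain n where n: "order G = 2 * n + 1" using odd by (elim oddE)
  obtain a where a: "a \<in> carrier G" and alt: "alternating A a"
    using reducible_imp_alternating[OF fin A red] .
  have "carrier G = (\<lambda>k. a [^] k) ` {..<order G}"
    using carrier_eq_powers[OF fin a] alternating_imp_odd_powers(1)[OF fin n A a alt] n by simp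
  \<comment> \<open>\<open>cyclic_group\<close> is characterised by integer powers, so the natural
    ones are embedded.\<close>
  then have "carrier G \<subseteq> range (\<lambda>k::int. a [^] k)"
    by (auto simp flip: int_pow_int)
  then show ?thesis
    unfolding cyclic_group using a by (intro bexI[of _ a]) auto
qed

end

section \<open>The cyclic groups of odd order\<close>

text \<open>The bound makes the modulus exceed 1, as the locale \<open>residues\<close>
  demands.\<close>

locale odd_residues =
  fixes n :: nat
  assumes n_ge_1: "n \<ge> 1"
begin

sublocale residues "2 * int n + 1" "Zring n"
  using n_ge_1 by unfold_locales auto

lemma group_Zgroup: "group (Zgroup n)"
  by (rule a_group)

lemma finite_Zgroup: "finite (carrier (Zgroup n))"
  by simp

lemma order_Zgroup: "order (Zgroup n) = 2 * n + 1"
  by (simp add: order_def res_carrier_eq)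

lemma Zgroup_pow: "a [^]\<^bsub>Zgroup n\<^esub> (k::nat) = (int k * a) mod (2 * int n + 1)"
proof (induction k)
  case (Suc k)
  have "a [^]\<^bsub>Zgroup n\<^esub> Suc k = a [^]\<^bsub>Zgroup n\<^esub> k \<oplus>\<^bsub>Zring n\<^esub> a"
    by simp
  also have "\<dots> = (int k * a + a) mod (2 * int n + 1)"
    unfolding Suc res_add_eq by (rule mod_add_left_eq)
  finally show ?case
    by (simp only: of_nat_Suc distrib_right mult_1_left add.commute)
qed (simp add: res_zero_eq)

lemma odd_powers_eq: "mult_map n a ` Odds n = group.odd_powers (Zgroup n) n a"
  unfolding Odds_def group.odd_powers_def[OF group_Zgroup] image_image mult_map_def
proof (rule image_cong)
  fix k assume "k \<in> {1..n}"
  \<comment> \<open>The integer and the natural subtraction agree because k is at least 1.\<close>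
  then have "2 * int k - 1 = int (2 * k - 1)"
    by (simp add: of_nat_diff)
  then show "a \<otimes>\<^bsub>Zring n\<^esub> (2 * int k - 1) = a [^]\<^bsub>Zgroup n\<^esub> (2 * k - 1)"
    unfolding Zgroup_pow res_mult_eq by (simp only: mult.commute)
qed simp

text \<open>Units are exactly the additive generators: coprimality cancels \<open>a\<close> from a
  multiple divisible by 2n + 1, and conversely a generator has 1 among its multiples, which yields
  an inverse.\<close>

lemma Units_iff_ord:
  "a \<in> Units (Zring n) \<longleftrightarrow> a \<in> carrier (Zring n) \<and> group.ord (Zgroup n) a = 2 * n + 1"
proof safe
  assume a: "a \<in> Units (Zring n)"
  then show aC: "a \<in> carrier (Zring n)" by (simp add: Units_closed)
  have cop: "coprime a (2 * int n + 1)" using a by (simp add: res_units_eq)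
  have "(a [^]\<^bsub>Zgroup n\<^esub> k = \<zero>\<^bsub>Zring n\<^esub>) = (2 * n + 1 dvd k)" for k :: nat
  proof -
    have "(a [^]\<^bsub>Zgroup n\<^esub> k = \<zero>\<^bsub>Zring n\<^esub>) = (2 * int n + 1 dvd int k * a)"
      unfolding Zgroup_pow unfolding res_zero_eq by (rule dvd_eq_mod_eq_0[symmetric])
    also have "\<dots> = (2 * int n + 1 dvd int k)"
      using cop by (simp add: coprime_dvd_mult_left_iff coprime_commute)
    also have "\<dots> = (int (2 * n + 1) dvd int k)" by (simp add: add.commute)
    finally show ?thesis by (simp only: int_dvd_int_iff)
  qed
  then show "group.ord (Zgroup n) a = 2 * n + 1"
    using aC by (subst group.ord_unique[OF group_Zgroup]) auto
next
  assume a: "a \<in> carrier (Zring n)" and ord: "group.ord (Zgroup n) a = 2 * n + 1"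
  have "\<one>\<^bsub>Zring n\<^esub> \<in> (\<lambda>k::nat. a [^]\<^bsub>Zgroup n\<^esub> k) ` {..<order (Zgroup n)}"
    using group.carrier_eq_powers[OF group_Zgroup finite_Zgroup, of a] a ord order_Zgroup by auto
  then obtain k :: nat where "\<one>\<^bsub>Zring n\<^esub> = (int k * a) mod (2 * int n + 1)"
    unfolding Zgroup_pow by blast
  \<comment> \<open>The multiplier is reduced so that it lies in the carrier and can serve as the
    inverse.\<close>
  then have "(int k mod (2 * int n + 1)) \<otimes>\<^bsub>Zring n\<^esub> a = \<one>\<^bsub>Zring n\<^esub>"
    by (simp add: res_mult_eq mod_simps)
  then show "a \<in> Units (Zring n)"
    using a m_comm[of a "int k mod (2 * int n + 1)"] unfolding Units_def by auto
qed

lemma game_subset_and_arrow_iff: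
  assumes a: "a \<in> Units (Zring n)"
  shows "game_subset (Zgroup n) (mult_map n a ` Odds n)"
    and "b \<in> carrier (Zring n) \<Longrightarrow>
      reducible_via_arrow (carrier (Zgroup n))
        (assoc_game (Zgroup n) (mult_map n a ` Odds n)) \<zero>\<^bsub>Zring n\<^esub> b \<longleftrightarrow> b = a"
proof -
  have aC: "a \<in> carrier (Zgroup n)" and ord: "group.ord (Zgroup n) a = 2 * n + 1"
    using a Units_iff_ord by auto
  show gs: "game_subset (Zgroup n) (mult_map n a ` Odds n)"
    unfolding odd_powers_eq
    by (rule group.game_subset_odd_powers[OF group_Zgroup finite_Zgroup order_Zgroup aC ord])
  assume b: "b \<in> carrier (Zring n)"
  have "reducible_via_arrow (carrier (Zgroup n))
        (assoc_game (Zgroup n) (mult_map n a ` Odds n)) \<zero>\<^bsub>Zring n\<^esub> b \<longleftrightarrow>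
      group.alternating (Zgroup n) (mult_map n a ` Odds n) (inv\<^bsub>Zgroup n\<^esub> \<one>\<^bsub>Zgroup n\<^esub> \<otimes>\<^bsub>Zgroup n\<^esub> b)"
    using group.reducible_via_arrow_iff_alternating[OF group_Zgroup finite_Zgroup gs
        monoid.one_closed[OF group.is_monoid[OF group_Zgroup]], of b] b by simp
  also have "inv\<^bsub>Zgroup n\<^esub> \<one>\<^bsub>Zgroup n\<^esub> \<otimes>\<^bsub>Zgroup n\<^esub> b = b"
    using b group_Zgroup by (simp add: monoid.inv_one group.is_monoid monoid.l_one del: monoid.simps)
  also have "group.alternating (Zgroup n) (mult_map n a ` Odds n) b \<longleftrightarrow> b = a"
    unfolding odd_powers_eq
    using group.alternating_odd_powers_unique[OF group_Zgroup finite_Zgroup order_Zgroup aC ord]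
      group.alternating_odd_powers[OF group_Zgroup finite_Zgroup order_Zgroup aC ord n_ge_1] by blast
  finally show "reducible_via_arrow (carrier (Zgroup n))
        (assoc_game (Zgroup n) (mult_map n a ` Odds n)) \<zero>\<^bsub>Zring n\<^esub> b \<longleftrightarrow> b = a" .
qed

lemma reducible_imp_unique_multiplier:
  assumes A: "game_subset (Zgroup n) A"
    and red: "reducible (carrier (Zgroup n)) (assoc_game (Zgroup n) A)"
  shows "\<exists>!a. a \<in> Units (Zring n) \<and> A = mult_map n a ` Odds n"
proof -
  obtain a where a: "a \<in> carrier (Zgroup n)" and alt: "group.alternating (Zgroup n) A a"
    using group.reducible_imp_alternating[OF group_Zgroup finite_Zgroup A red] .
  note * = group.alternating_imp_odd_powers[OF group_Zgroup finite_Zgroup order_Zgroup A a alt]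
  show ?thesis
  proof (rule ex1I[of _ a])
    show "a \<in> Units (Zring n) \<and> A = mult_map n a ` Odds n"
      using * a by (simp add: Units_iff_ord odd_powers_eq)
    fix b assume "b \<in> Units (Zring n) \<and> A = mult_map n b ` Odds n"
    \<comment> \<open>The element \<open>a\<close> alternates on A, which is also the set of odd
      powers of \<open>b\<close>, so it must coincide with \<open>b\<close>.\<close>
    then show "b = a"
      using group.alternating_odd_powers_unique[OF group_Zgroup finite_Zgroup order_Zgroup, of b a] alt
      by (auto simp: Units_iff_ord odd_powers_eq)
  qed
qed

end

theorem theorem3p18:
  fixes n :: nat
    and G :: "('a, 'b) monoid_scheme"
  shows "(n \<ge> 1 \<longrightarrow>
           (\<forall>A. game_subset (Zgroup n) A \<and>
                reducible (carrier (Zgroup n)) (assoc_game (Zgroup n) A) \<longrightarrow>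
                (\<exists>!a. a \<in> Units (Zring n) \<and> A = mult_map n a ` Odds n)) \<and>
           (\<forall>a \<in> Units (Zring n).
                game_subset (Zgroup n) (mult_map n a ` Odds n) \<and>
                (\<forall>b \<in> carrier (Zring n).
                   reducible_via_arrow (carrier (Zgroup n))
                     (assoc_game (Zgroup n) (mult_map n a ` Odds n)) \<zero>\<^bsub>Zring n\<^esub> b
                   \<longleftrightarrow> b = a)))
       \<and> (group G \<and> finite (carrier G) \<and> odd (order G) \<and> \<not> cyclic_group G \<longrightarrow>
           (\<forall>A. game_subset G A \<longrightarrow> \<not> reducible (carrier G) (assoc_game G A)))"
proof (intro conjI impI)
  assume "n \<ge> 1"
  then interpret odd_residues n by unfold_locales
  show "\<forall>A. game_subset (Zgroup n) A \<and>
          reducible (carrier (Zgroup n)) (assoc_game (Zgroup n) A) \<longrightarrow>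
          (\<exists>!a. a \<in> Units (Zring n) \<and> A = mult_map n a ` Odds n)"
    using reducible_imp_unique_multiplier by blast
  show "\<forall>a \<in> Units (Zring n).
          game_subset (Zgroup n) (mult_map n a ` Odds n) \<and>
          (\<forall>b \<in> carrier (Zring n).
             reducible_via_arrow (carrier (Zgroup n))
               (assoc_game (Zgroup n) (mult_map n a ` Odds n)) \<zero>\<^bsub>Zring n\<^esub> b
             \<longleftrightarrow> b = a)"
    using game_subset_and_arrow_iff by blast
next
  assume "group G \<and> finite (carrier G) \<and> odd (order G) \<and> \<not> cyclic_group G"
  then show "\<forall>A. game_subset G A \<longrightarrow> \<not> reducible (carrier G) (assoc_game G A)"
    using group.reducible_imp_cyclic by blast
qed

end
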